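(* Let $j\geq m\geq 2$ and $n\geq 2$ be integers. Then \[ \Big\lfloor \frac{n-1}{\lceil \frac{j}{m-1}\rceil-1}\Big\rfloor+1\leq m_j(K_m,K_{1,n})\leq \Big\lfloor \frac{n-1}{\frac{j}{m-1}-1}\Big\rfloor+1 . \]
   Context: All graphs are simple; $K_m$ is the complete graph on $m$ vertices and $K_{1,n}$ is the star with $n+1$ vertices ($n$ leaves). For integers $j\geq 2$ and $t\geq 1$, $K_{j\times t}$ denotes the complete multipartite graph with $j$ parts, each of size $t$. For graphs $H$ and $G$, the size multipartite Ramsey number $m_j(H,G)$ is the smallest natural number $t$ such that every coloring of the edges of $K_{j\times t}$ with two colors red and blue contains a red copy of $H$ or a blue copy of $G$ as a subgraph. *)

theory Defs
  imports Complex_Main "HOL-Library.Extended_Nat"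
begin

text \<open>A graph is a pair of a vertex set and a set of edges, an edge being an unordered
  pair of distinct vertices.\<close>

type_synonym 'a graph = "'a set \<times> 'a set set"

abbreviation verts :: "'a graph \<Rightarrow> 'a set" where
  "verts G \<equiv> fst G"

abbreviation edges :: "'a graph \<Rightarrow> 'a set set" where
  "edges G \<equiv> snd G"

definition simple_graph :: "'a graph \<Rightarrow> bool" where
  "simple_graph G \<longleftrightarrow> (\<forall>e \<in> edges G. e \<subseteq> verts G \<and> card e = 2)"

definition complete_graph :: "nat \<Rightarrow> nat graph" where
  "complete_graph m = ({..<m}, {{u, v} | u v. u < m \<and> v < m \<and> u \<noteq> v})"

text \<open>The centre of the star is \<open>0\<close>, its leaves are \<open>1, \<dots>, n\<close>.\<close>

definition star_graph :: "nat \<Rightarrow> nat graph" where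
  "star_graph n = ({0..n}, {{0, v} | v. v \<in> {1..n}})"

text \<open>The vertex \<open>(i, k)\<close> is the \<open>k\<close>-th vertex of the \<open>i\<close>-th part.\<close>

definition complete_multipartite :: "nat \<Rightarrow> nat \<Rightarrow> (nat \<times> nat) graph" where
  "complete_multipartite j t =
     ({..<j} \<times> {..<t},
      {{x, y} | x y. x \<in> {..<j} \<times> {..<t} \<and> y \<in> {..<j} \<times> {..<t} \<and> fst x \<noteq> fst y})"

lemma simple_complete_graph: "simple_graph (complete_graph m)"
  by (auto simp: simple_graph_def complete_graph_def)

lemma simple_star_graph: "simple_graph (star_graph n)"
  by (auto simp: simple_graph_def star_graph_def card_2_iff)

lemma simple_complete_multipartite: "simple_graph (complete_multipartite j t)"
  by (fastforce simp: simple_graph_def complete_multipartite_def card_2_iff)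

text \<open>Copies are subgraphs, not necessarily induced.\<close>

definition contains_copy :: "'a graph \<Rightarrow> 'b graph \<Rightarrow> bool" where
  "contains_copy G H \<longleftrightarrow>
     (\<exists>f. inj_on f (verts H) \<and> f ` verts H \<subseteq> verts G \<and> (\<forall>e \<in> edges H. f ` e \<in> edges G))"

datatype colour = Red | Blue

definition colour_class :: "'a graph \<Rightarrow> ('a set \<Rightarrow> colour) \<Rightarrow> colour \<Rightarrow> 'a graph" where
  "colour_class G c k = (verts G, {e \<in> edges G. c e = k})"

definition ramsey_arrows :: "'a graph \<Rightarrow> 'b graph \<Rightarrow> 'c graph \<Rightarrow> bool" where
  "ramsey_arrows F H G \<longleftrightarrow>
     (\<forall>c. contains_copy (colour_class F c Red) H \<or> contains_copy (colour_class F c Blue) G)"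

text \<open>The value is \<open>\<infinity>\<close> if no \<open>t\<close> has the required property, so an upper bound by a natural
  number includes the existence of such a \<open>t\<close>.\<close>

definition size_multipartite_ramsey :: "nat \<Rightarrow> 'b graph \<Rightarrow> 'c graph \<Rightarrow> enat" where
  "size_multipartite_ramsey j H G =
     Inf {enat t | t. t \<ge> 1 \<and> ramsey_arrows (complete_multipartite j t) H G}"

end

theory Submission
  imports Defs
begin

text \<open>Lower bound: distribute the \<open>j\<close> parts over \<open>m - 1\<close> groups of at most
  \<open>d = \<lceil>j / (m - 1)\<rceil>\<close> parts each, and colour an edge blue iff both ends lie in the same group.
  The red graph is \<open>(m - 1)\<close>-partite and all blue degrees are at most \<open>(d - 1) t\<close>.

  Upper bound: if all blue degrees are at most \<open>n - 1\<close>, each vertex has at most \<open>t + n - 1\<close>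
  vertices, itself included, that are not red neighbours of it. When \<open>(m - 1) (t + n - 1) < j t\<close>,
  a red clique of \<open>m\<close> vertices can therefore be picked greedily.\<close>

text \<open>Every pair of vertices of \<open>complete_graph m\<close> is an edge, so only the image
  of an embedding matters. Both bounds can then speak of cliques as vertex sets and avoid
  embeddings.\<close>

lemma contains_copy_complete_graph_iff:
  "contains_copy G (complete_graph m) \<longleftrightarrow>
    (\<exists>S \<subseteq> verts G. finite S \<and> card S = m \<and> (\<forall>x\<in>S. \<forall>y\<in>S. x \<noteq> y \<longrightarrow> {x, y} \<in> edges G))"
proof
  assume "contains_copy G (complete_graph m)"
  then obtain f where f: "inj_on f {..<m}" "f ` {..<m} \<subseteq> verts G"
    and e': "\<forall>e \<in> edges (complete_graph m). f ` e \<in> edges G"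
    by (auto simp: contains_copy_def complete_graph_def)
  have e: "f ` {u, v} \<in> edges G" if "u < m" "v < m" "u \<noteq> v" for u v
    using that by (intro e'[rule_format]) (auto simp: complete_graph_def)
  have "{x, y} \<in> edges G" if "x \<in> f ` {..<m}" "y \<in> f ` {..<m}" "x \<noteq> y" for x y
    using that e by auto
  then show "\<exists>S \<subseteq> verts G. finite S \<and> card S = m \<and>
      (\<forall>x\<in>S. \<forall>y\<in>S. x \<noteq> y \<longrightarrow> {x, y} \<in> edges G)"
    using f by (intro exI[of _ "f ` {..<m}"]) (auto simp: card_image)
next
  assume "\<exists>S \<subseteq> verts G. finite S \<and> card S = m \<and>
    (\<forall>x\<in>S. \<forall>y\<in>S. x \<noteq> y \<longrightarrow> {x, y} \<in> edges G)"
  then obtain S where S: "S \<subseteq> verts G" "finite S" "card S = m"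
    "\<And>x y. x \<in> S \<Longrightarrow> y \<in> S \<Longrightarrow> x \<noteq> y \<Longrightarrow> {x, y} \<in> edges G" by blast
  obtain f where f: "bij_betw f {..<m} S"
    using ex_bij_betw_nat_finite[OF S(2)] S(3) by (auto simp: atLeast0LessThan)
  then have "inj_on f {..<m}" "f ` {..<m} = S" by (auto simp: bij_betw_def)
  moreover have "f ` {u, v} \<in> edges G" if "u < m" "v < m" "u \<noteq> v" for u v
    using that calculation S(4)[of "f u" "f v"] by (auto dest: inj_onD)
  ultimately show "contains_copy G (complete_graph m)"
    unfolding contains_copy_def complete_graph_def fst_conv snd_conv
    using S(1) by (intro exI[of _ f]) blast
qed

text \<open>The image of the centre 0 is the vertex of large degree. Simplicity keeps neighbours
  inside the vertex set and the centre off its own neighbourhood; finiteness matters because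
  \<open>card\<close> of an infinite neighbourhood would be 0.\<close>

lemma contains_copy_star_graph_iff:
  assumes "simple_graph G" and "finite (verts G)"
  shows "contains_copy G (star_graph n) \<longleftrightarrow>
    (\<exists>x \<in> verts G. n \<le> card {y. {x, y} \<in> edges G})"
proof
  assume "contains_copy G (star_graph n)"
  then obtain f where f: "inj_on f {0..n}" "f ` {0..n} \<subseteq> verts G"
    and e': "\<forall>e \<in> edges (star_graph n). f ` e \<in> edges G"
    by (auto simp: contains_copy_def star_graph_def)
  have e: "f ` {0, v} \<in> edges G" if "v \<in> {1..n}" for v
    using that by (intro e'[rule_format]) (auto simp: star_graph_def)
  have "{y. {f 0, y} \<in> edges G} \<subseteq> verts G"
    using assms(1) by (auto simp: simple_graph_def)
  then have fin: "finite {y. {f 0, y} \<in> edges G}"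
    using assms(2) finite_subset by blast
  have "f ` {1..n} \<subseteq> {y. {f 0, y} \<in> edges G}" using e by auto
  moreover have "card (f ` {1..n}) = n"
    using inj_on_subset[OF f(1), of "{1..n}"] by (simp add: card_image)
  ultimately have "n \<le> card {y. {f 0, y} \<in> edges G}"
    using card_mono[OF fin] by metis
  then show "\<exists>x \<in> verts G. n \<le> card {y. {x, y} \<in> edges G}"
    using f(2) by (intro bexI[of _ "f 0"]) auto
next
  assume "\<exists>x \<in> verts G. n \<le> card {y. {x, y} \<in> edges G}"
  then obtain x where x: "x \<in> verts G" "n \<le> card {y. {x, y} \<in> edges G}" by blast
  obtain S where S: "S \<subseteq> {y. {x, y} \<in> edges G}" "card S = n" "finite S"
    using obtain_subset_with_card_n[OF x(2)] by metis
  have xS: "x \<notin> S"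
  proof
    assume "x \<in> S"
    then have "{x, x} \<in> edges G" using S(1) by blast
    then have "card {x, x} = 2" using assms(1) unfolding simple_graph_def by blast
    then show False by simp
  qed
  have SV: "S \<subseteq> verts G" using S(1) assms(1) unfolding simple_graph_def by blast
  obtain g where g: "bij_betw g {1..n} S"
    using ex_bij_betw_nat_finite_1[OF S(3)] S(2) by blast
  \<comment> \<open>The bijection \<open>g\<close> places only the leaves 1 to \<open>n\<close>; the
    centre 0 is sent to \<open>x\<close>, which lies outside \<open>S\<close>.\<close>
  define f where "f = g(0 := x)"
  have f0: "f 0 = x" and fg: "\<And>v. v \<in> {1..n} \<Longrightarrow> f v = g v" by (auto simp: f_def)
  have "bij_betw f {1..n} S" using g bij_betw_cong[of "{1..n}" f g S] fg by blast
  then have fS: "f ` {1..n} = S" and "inj_on f {1..n}" by (auto simp: bij_betw_def)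
  have I: "{0..n} = insert 0 {1..n}" by auto
  have "inj_on f {0..n}"
    unfolding I inj_on_insert using \<open>inj_on f {1..n}\<close> fS xS f0 by auto
  moreover have "f ` {0..n} \<subseteq> verts G" using I fS f0 SV x(1) by auto
  moreover have "f ` {0, v} \<in> edges G" if "v \<in> {1..n}" for v
  proof -
    have "f v \<in> S" using that fS by blast
    then show ?thesis using S(1) f0 by auto
  qed
  ultimately show "contains_copy G (star_graph n)"
    unfolding contains_copy_def star_graph_def fst_conv snd_conv
    by (intro exI[of _ f]) blast
qed

lemma simple_graph_colour_class: "simple_graph G \<Longrightarrow> simple_graph (colour_class G c k)"
  by (auto simp: simple_graph_def colour_class_def)

lemma verts_colour_class [simp]: "verts (colour_class G c k) = verts G"
  by (simp add: colour_class_def)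

lemma edges_colour_class: "e \<in> edges (colour_class G c k) \<longleftrightarrow> e \<in> edges G \<and> c e = k"
  by (simp add: colour_class_def)

lemma verts_complete_multipartite [simp]:
  "verts (complete_multipartite j t) = {..<j} \<times> {..<t}"
  by (simp add: complete_multipartite_def)

lemma edges_complete_multipartite:
  "{x, y} \<in> edges (complete_multipartite j t) \<longleftrightarrow>
    x \<in> {..<j} \<times> {..<t} \<and> y \<in> {..<j} \<times> {..<t} \<and> fst x \<noteq> fst y"
  by (fastforce simp: complete_multipartite_def doubleton_eq_iff)

text \<open>The first hypothesis lets \<open>m - 1\<close> blocks of \<open>d\<close> consecutive
  parts cover all \<open>j\<close> parts; the second keeps every blue degree below
  \<open>n\<close>.\<close>

lemma not_ramsey_arrows_multipartite:
  assumes "j \<le> d * (m - 1)" and "(d - 1) * t < n" and "m \<ge> 1"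
  shows "\<not> ramsey_arrows (complete_multipartite j t) (complete_graph m) (star_graph n)"
proof -
  \<comment> \<open>Part \<open>i\<close> belongs to group \<open>i div d\<close>. A colouring takes
    an edge as an unordered set, so "same group" is expressed by the set of group indices being a
    singleton.\<close>
  define c where
    "c e = (if card ((\<lambda>x. fst x div d) ` e) = 1 then Blue else Red)" for e :: "(nat \<times> nat) set"
  have c: "c {x, y} = Blue \<longleftrightarrow> fst x div d = fst y div d" for x y
    by (auto simp: c_def card_1_singleton_iff)
  let ?F = "complete_multipartite j t"
  have sg: "simple_graph (colour_class ?F c k)" for k
    by (simp add: simple_graph_colour_class simple_complete_multipartite)
  have "\<not> contains_copy (colour_class ?F c Red) (complete_graph m)"
  proof
    assume "contains_copy (colour_class ?F c Red) (complete_graph m)"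
    then obtain S where S: "S \<subseteq> {..<j} \<times> {..<t}" "finite S" "card S = m"
      and r: "\<And>x y. x \<in> S \<Longrightarrow> y \<in> S \<Longrightarrow> x \<noteq> y \<Longrightarrow> c {x, y} = Red"
      unfolding contains_copy_complete_graph_iff edges_colour_class by auto
    \<comment> \<open>Pigeonhole: a red clique has at most one vertex in each of the at most
      \<open>m - 1\<close> groups.\<close>
    have "inj_on (\<lambda>x. fst x div d) S"
    proof (rule inj_onI, rule ccontr)
      fix x y assume "x \<in> S" "y \<in> S" "fst x div d = fst y div d" "x \<noteq> y"
      then show False using c[of x y] r[of x y] by simp
    qed
    moreover have "(\<lambda>x. fst x div d) ` S \<subseteq> {..<m - 1}"
    proof
      fix q assume "q \<in> (\<lambda>x. fst x div d) ` S"
      then obtain x where x: "x \<in> S" "q = fst x div d" by blast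
      then have "fst x < (m - 1) * d" using S(1) assms(1) by (auto simp: mult.commute)
      then show "q \<in> {..<m - 1}" using x(2) by (simp add: less_mult_imp_div_less)
    qed
    ultimately have "card S \<le> m - 1" using card_inj_on_le[of _ S "{..<m - 1}"] by auto
    then show False using S(3) assms(3) by simp
  qed
  moreover have "\<not> contains_copy (colour_class ?F c Blue) (star_graph n)"
  proof
    assume "contains_copy (colour_class ?F c Blue) (star_graph n)"
    then obtain x where x: "x \<in> {..<j} \<times> {..<t}"
      and n: "n \<le> card {y. {x, y} \<in> edges (colour_class ?F c Blue)}"
      by (auto simp: contains_copy_star_graph_iff[OF sg])
    define q where "q = fst x div d"
    \<comment> \<open>If \<open>d = 0\<close> then \<open>j = 0\<close>, and there would be no
      vertex \<open>x\<close>. Positivity is needed since \<open>i div 0 = 0\<close> while the block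
      would be empty.\<close>
    have "d > 0" using x assms(1) by (cases d) auto
    then have block: "i \<in> {d * q..<d * q + d}" if "i div d = q" for i
      using that by (metis atLeastLessThan_iff dividend_less_times_div times_div_less_eq_dividend
          mult.commute add.commute)
    \<comment> \<open>Removing the part of \<open>x\<close> itself, where it has no neighbours,
      leaves \<open>d - 1\<close> parts. An inclusion suffices: the last block may extend beyond
      part \<open>j - 1\<close>.\<close>
    have "{y. {x, y} \<in> edges (colour_class ?F c Blue)}
        \<subseteq> ({d * q..<d * q + d} - {fst x}) \<times> {..<t}"
    proof
      fix y assume "y \<in> {y. {x, y} \<in> edges (colour_class ?F c Blue)}"
      then have "y \<in> {..<j} \<times> {..<t}" "fst x \<noteq> fst y" "fst y div d = q"
        using c[of x y] by (auto simp: edges_colour_class edges_complete_multipartite q_def)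
      then show "y \<in> ({d * q..<d * q + d} - {fst x}) \<times> {..<t}"
        using block[of "fst y"] by (cases y) auto
    qed
    then have "n \<le> card (({d * q..<d * q + d} - {fst x}) \<times> {..<t})"
      using n by (meson card_mono finite_Diff finite_SigmaI finite_atLeastLessThan
          finite_lessThan order_trans)
    also have "\<dots> = (d - 1) * t"
      using block[of "fst x"] by (simp add: q_def)
    finally show False using assms(2) by simp
  qed
  ultimately show ?thesis unfolding ramsey_arrows_def by blast
qed

text \<open>The hypothesis says that \<open>m - 1\<close> sets of size at most
  \<open>t + n - 1\<close> cannot cover the \<open>j * t\<close> vertices, so the greedy choice
  never gets stuck before the \<open>m\<close>-th vertex. With \<open>n \<ge> 1\<close> the
  truncated subtraction is exact.\<close>

lemma ramsey_arrows_multipartite: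
  assumes "(m - 1) * (t + n - 1) < j * t" and "n \<ge> 1"
  shows "ramsey_arrows (complete_multipartite j t) (complete_graph m) (star_graph n)"
  unfolding ramsey_arrows_def
proof (intro allI disjCI)
  fix c
  let ?F = "complete_multipartite j t"
  let ?V = "{..<j} \<times> {..<t}"
  let ?B = "\<lambda>x. {y. {x, y} \<in> edges (colour_class ?F c Blue)}"
  \<comment> \<open>The vertices that cannot join a red clique through \<open>x\<close>: the whole
    part of \<open>x\<close>, which contains \<open>x\<close>, and its blue neighbours.\<close>
  let ?N = "\<lambda>x. {fst x} \<times> {..<t} \<union> ?B x"
  have sg: "simple_graph (colour_class ?F c k)" for k
    by (simp add: simple_graph_colour_class simple_complete_multipartite)
  assume "\<not> contains_copy (colour_class ?F c Blue) (star_graph n)"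
  then have deg: "card (?B x) < n" if "x \<in> ?V" for x
    using that contains_copy_star_graph_iff[OF sg, of Blue n] by (auto simp: not_le)
  have cardN: "card (?N x) \<le> t + n - 1" if "x \<in> ?V" for x
    using card_Un_le[of "{fst x} \<times> {..<t}" "?B x"] deg[OF that] by simp
  have finB: "finite (?B x)" for x
    by (rule finite_subset[of _ ?V]) (auto simp: edges_colour_class edges_complete_multipartite)
  have "\<exists>S \<subseteq> ?V. finite S \<and> card S = k \<and>
      (\<forall>x\<in>S. \<forall>y\<in>S. x \<noteq> y \<longrightarrow> {x, y} \<in> edges (colour_class ?F c Red))" if "k \<le> m" for k
    using that
  proof (induction k)
    case 0
    show ?case by (rule exI[of _ "{}"]) auto
  next
    case (Suc k)
    then obtain S where S: "S \<subseteq> ?V" "finite S" "card S = k"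
      and r: "\<And>x y. x \<in> S \<Longrightarrow> y \<in> S \<Longrightarrow> x \<noteq> y \<Longrightarrow> {x, y} \<in> edges (colour_class ?F c Red)"
      by (meson Suc_leD)
    \<comment> \<open>A union bound over the \<open>k \<le> m - 1\<close> vertices chosen so far
      leaves some vertex \<open>v\<close> outside all the sets \<open>?N x\<close>.\<close>
    have "card (\<Union>x\<in>S. ?N x) \<le> (\<Sum>x\<in>S. card (?N x))" by (rule card_UN_le[OF S(2)])
    also have "\<dots> \<le> k * (t + n - 1)"
      using sum_bounded_above[of S "\<lambda>x. card (?N x)" "t + n - 1"] cardN S by auto
    also have "\<dots> \<le> (m - 1) * (t + n - 1)" using Suc.prems by (intro mult_right_mono) auto
    also have "\<dots> < card ?V" using assms(1) by simp
    finally have "\<not> ?V \<subseteq> (\<Union>x\<in>S. ?N x)"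
      using card_mono[of "\<Union>x\<in>S. ?N x" ?V] S(2) finB by (auto simp: not_le)
    then obtain v where v: "v \<in> ?V" "\<And>x. x \<in> S \<Longrightarrow> v \<notin> ?N x" by blast
    have red: "{x, v} \<in> edges (colour_class ?F c Red)" if "x \<in> S" for x
    proof -
      have "fst x \<noteq> fst v" using v(1) v(2)[OF that] by (cases v) auto
      then have "{x, v} \<in> edges ?F" using v(1) that S(1) by (auto simp: edges_complete_multipartite)
      moreover have "c {x, v} \<noteq> Blue" using v(2)[OF that] calculation by (auto simp: edges_colour_class)
      ultimately show ?thesis by (cases "c {x, v}") (auto simp: edges_colour_class)
    qed
    \<comment> \<open>Each vertex lies in its own \<open>?N\<close>, so \<open>v\<close> is new and
      the clique really grows.\<close>
    have "v \<notin> S" using v(1) v(2)[of v] by (cases v) auto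
    then show ?case
      using S v(1) r red by (intro exI[of _ "insert v S"]) (auto simp: insert_commute)
  qed
  then show "contains_copy (colour_class ?F c Red) (complete_graph m)"
    unfolding contains_copy_complete_graph_iff by simp
qed

theorem theorem4:
  fixes j m n :: nat
  assumes "j \<ge> m" and "m \<ge> 2" and "n \<ge> 2"
  shows "enat (nat \<lfloor>(real n - 1) / (real_of_int \<lceil>real j / (real m - 1)\<rceil> - 1)\<rfloor> + 1)
           \<le> size_multipartite_ramsey j (complete_graph m) (star_graph n)
       \<and> size_multipartite_ramsey j (complete_graph m) (star_graph n)
           \<le> enat (nat \<lfloor>(real n - 1) / (real j / (real m - 1) - 1)\<rfloor> + 1)"
proof
  define r where "r = real j / (real m - 1)"
  have m1: "real m - 1 > 0" using assms by simp
  \<comment> \<open>Strict because \<open>j \<ge> m > m - 1\<close>; this makes both denominators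
    \<open>r - 1\<close> and \<open>d - 1\<close> positive.\<close>
  have r1: "r > 1" using assms m1 by (simp add: r_def)
  define d where "d = nat \<lceil>r\<rceil>"
  have d: "real d = real_of_int \<lceil>r\<rceil>" using r1 by (simp add: d_def)
  have rd: "r \<le> real d" unfolding d by linarith
  have d2: "d \<ge> 2" using rd r1 by simp
  have "real j \<le> real d * (real m - 1)" using rd m1 by (simp add: r_def field_simps)
  also have "\<dots> = real (d * (m - 1))" using assms by (simp add: of_nat_diff)
  finally have jd: "j \<le> d * (m - 1)" by linarith
  show "enat (nat \<lfloor>(real n - 1) / (real_of_int \<lceil>real j / (real m - 1)\<rceil> - 1)\<rfloor> + 1)
           \<le> size_multipartite_ramsey j (complete_graph m) (star_graph n)"
    unfolding size_multipartite_ramsey_def r_def[symmetric] d[symmetric]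
  proof (rule Inf_greatest, clarify)
    fix t
    assume arr: "ramsey_arrows (complete_multipartite j t) (complete_graph m) (star_graph n)"
    have "\<not> (d - 1) * t < n"
      using not_ramsey_arrows_multipartite[OF jd, of t n] arr assms by auto
    then have "real n \<le> real ((d - 1) * t)" by linarith
    \<comment> \<open>Passing from \<open>n\<close> to \<open>n - 1\<close> makes the inequality
      strict, so the floor of the quotient is below the integer \<open>t\<close> and the
      \<open>+ 1\<close> of the bound is absorbed.\<close>
    then have "real n - 1 < (real d - 1) * real t" using d2 by (simp add: of_nat_diff)
    then have "(real n - 1) / (real d - 1) < real t" using d2 by (simp add: field_simps)
    then have "\<lfloor>(real n - 1) / (real d - 1)\<rfloor> < int t" by linarith
    moreover have "0 \<le> \<lfloor>(real n - 1) / (real d - 1)\<rfloor>" using d2 assms by simp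
    ultimately have "nat \<lfloor>(real n - 1) / (real d - 1)\<rfloor> + 1 \<le> t" by linarith
    then show "enat (nat \<lfloor>(real n - 1) / (real d - 1)\<rfloor> + 1) \<le> enat t"
      by (simp only: enat_ord_simps)
  qed
  \<comment> \<open>The least natural number strictly above the quotient. The strict inequality,
    with denominators cleared, is exactly the counting hypothesis, because
    \<open>r * (m - 1) = j\<close>.\<close>
  define t where "t = nat \<lfloor>(real n - 1) / (r - 1)\<rfloor> + 1"
  have "0 \<le> (real n - 1) / (r - 1)" using r1 assms by simp
  then have "(real n - 1) / (r - 1) < real t" unfolding t_def by linarith
  then have "real n - 1 < real t * (r - 1)" using r1 by (simp add: field_simps)
  then have "(real n - 1 + real t) * (real m - 1) < (real t * r) * (real m - 1)"
    using m1 by (intro mult_strict_right_mono) (auto simp: algebra_simps)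
  also have "\<dots> = real (j * t)" using m1 by (simp add: r_def)
  also have "(real n - 1 + real t) * (real m - 1) = real ((m - 1) * (t + n - 1))"
    using assms by (simp add: of_nat_diff mult.commute)
  finally have "(m - 1) * (t + n - 1) < j * t" by linarith
  then have "ramsey_arrows (complete_multipartite j t) (complete_graph m) (star_graph n)"
    using assms by (intro ramsey_arrows_multipartite) auto
  then show "size_multipartite_ramsey j (complete_graph m) (star_graph n)
           \<le> enat (nat \<lfloor>(real n - 1) / (real j / (real m - 1) - 1)\<rfloor> + 1)"
    unfolding size_multipartite_ramsey_def r_def[symmetric] t_def[symmetric]
    \<comment> \<open>The \<open>+ 1\<close> in \<open>t\<close> also gives
      \<open>t \<ge> 1\<close>, as membership in the set under the infimum demands.\<close>
    by (intro Inf_lower) (auto simp: t_def)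
qed

end
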